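(* Let $\mathfrak{A}$ be a residuated lattice. The following assertions are equivalent: (1) $\mathfrak{A}$ is mp; (2) $Min(\mathfrak{A})=Spp(\mathfrak{A})$, i.e. the minimal prime filters of $\mathfrak{A}$ are exactly its purely-prime filters.
   Context: A residuated lattice is an algebra $\mathfrak{A}=(A;\vee,\wedge,\odot,\rightarrow,0,1)$ such that $(A;\vee,\wedge,0,1)$ is a bounded lattice, $(A;\odot,1)$ is a commutative monoid, and $x\odot y\leq z$ iff $x\leq y\rightarrow z$ for all $x,y,z\in A$. A filter of $\mathfrak{A}$ is a non-empty subset $F\subseteq A$ with $x\odot y\in F$ for all $x,y\in F$, and $x\vee y\in F$ for all $x\in F$, $y\in A$. For filters $F,G$, $F\veebar G$ is the filter generated by $F\cup G$. A prime filter is a proper filter $\mathfrak{p}$ that is meet-irreducible among filters (equivalently, $x\vee y\in\mathfrak{p}$ implies $x\in\mathfrak{p}$ or $y\in\mathfrak{p}$); $Min(\mathfrak{A})$ is the set of inclusion-minimal prime filters. $\mathfrak{A}$ is mp if every prime filter contains a unique minimal prime filter. For $a\in A$, $a^{\perp}=\{b\in A\mid b\vee a=1\}$. For a filter $F$, $\sigma(F)$ is the intersection of all prime filters $\mathfrak{q}$ that are contained in some prime filter containing $F$ (the empty intersection being $A$); equivalently $\sigma(F)=\{a\in A\mid F\veebar a^{\perp}=A\}$. $F$ is pure if $\sigma(F)=F$; $\sigma(\mathfrak{A})$ denotes the set of pure filters. A proper pure filter $\mathfrak{p}$ is purely-prime if for all $F_1,F_2\in\sigma(\mathfrak{A})$,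 $F_1\cap F_2\subseteq\mathfrak{p}$ implies $F_1\subseteq\mathfrak{p}$ or $F_2\subseteq\mathfrak{p}$. $Spp(\mathfrak{A})$ is the set of purely-prime filters. *)

theory Defs
  imports Main
begin

text \<open>
  The unit of the monoid is the top of the lattice, which is why \<open>one_eq_top\<close> is an axiom: the
  library provides the two constants separately.  As in \<open>bounded_lattice\<close>, the one-element
  structure (\<open>bot = top\<close>) is allowed.  The carrier is the whole type, so ``proper'' means
  \<open>\<noteq> UNIV\<close>.
\<close>

class residuated_lattice = bounded_lattice + comm_monoid_mult +
  fixes residuum :: "'a \<Rightarrow> 'a \<Rightarrow> 'a"
  assumes one_eq_top: "1 = top"
    and residuation: "x * y \<le> z \<longleftrightarrow> x \<le> residuum y z"

definition rl_filters :: "'a::residuated_lattice set set" where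
  "rl_filters = {F. F \<noteq> {} \<and> (\<forall>x\<in>F. \<forall>y\<in>F. x * y \<in> F) \<and> (\<forall>x\<in>F. \<forall>y. sup x y \<in> F)}"

text \<open>Meets in the lattice of filters are intersections.\<close>

definition prime_filters :: "'a::residuated_lattice set set" where
  "prime_filters = {P \<in> rl_filters. P \<noteq> UNIV \<and>
     (\<forall>F\<in>rl_filters. \<forall>G\<in>rl_filters. F \<inter> G = P \<longrightarrow> F = P \<or> G = P)}"

definition minimal_prime_filters :: "'a::residuated_lattice set set" where
  "minimal_prime_filters = {P \<in> prime_filters. \<forall>Q\<in>prime_filters. Q \<subseteq> P \<longrightarrow> Q = P}"

definition is_mp :: "'a::residuated_lattice itself \<Rightarrow> bool" where
  "is_mp _ \<longleftrightarrow>
     (\<forall>P\<in>(prime_filters :: 'a set set). \<exists>!M. M \<in> minimal_prime_filters \<and> M \<subseteq> P)"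

text \<open>Since \<open>\<Inter>{} = UNIV\<close>, the empty intersection is the improper filter, as intended.\<close>

definition sigma_part :: "'a::residuated_lattice set \<Rightarrow> 'a set" where
  "sigma_part F = \<Inter>{Q \<in> prime_filters. \<exists>P\<in>prime_filters. F \<subseteq> P \<and> Q \<subseteq> P}"

definition pure_filters :: "'a::residuated_lattice set set" where
  "pure_filters = {F \<in> rl_filters. sigma_part F = F}"

definition purely_prime_filters :: "'a::residuated_lattice set set" where
  "purely_prime_filters = {P \<in> pure_filters. P \<noteq> UNIV \<and>
     (\<forall>F\<in>pure_filters. \<forall>G\<in>pure_filters. F \<inter> G \<subseteq> P \<longrightarrow> F \<subseteq> P \<or> G \<subseteq> P)}"

end

theory Submission
  imports Defs
begin

text \<open>
  The theorem rests on the coannihilators \<open>a\<^sup>\<bottom> = {b. b \<squnion> a = 1}\<close>.  A prime filter \<open>Q\<close> contains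
  \<open>a\<^sup>\<bottom>\<close> only if some minimal prime filter inside \<open>Q\<close> omits \<open>a\<close>
  (\<open>minimal_prime_omitting\<close>): the joins \<open>a \<squnion> u\<close> with \<open>u \<notin> Q\<close> form a join-closed set that
  avoids \<open>1\<close>, so a prime filter avoids it.

  Suppose the algebra is mp.  If a minimal prime filter \<open>M\<close> and a prime filter \<open>Q\<close> lie in a
  common prime filter, then \<open>M\<close> is also the minimal prime filter inside \<open>Q\<close>; so \<open>M\<close> is pure.  A
  prime filter is prime for pure filters in particular, hence minimal prime filters are
  purely-prime.
  For the other inclusion, two consequences of the fact above are combined: coannihilators are
  pure (\<open>mp_coannihilator_pure\<close>), and if \<open>x \<squnion> y = 1\<close> then \<open>x\<^sup>\<bottom>\<close> and \<open>y\<^sup>\<bottom>\<close> are comaximal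
  (\<open>mp_coannihilators_comaximal\<close>), say \<open>c \<in> x\<^sup>\<bottom>\<close>, \<open>d \<in> y\<^sup>\<bottom>\<close> and \<open>c * d = 0\<close>.  Then
  \<open>c\<^sup>\<bottom> \<inter> d\<^sup>\<bottom> = {1}\<close> with \<open>x \<in> c\<^sup>\<bottom>\<close> and \<open>y \<in> d\<^sup>\<bottom>\<close>, so a purely-prime filter contains \<open>x\<close> or
  \<open>y\<close> (\<open>mp_purely_prime_cover\<close>).  A purely-prime \<open>P\<close>, being pure, lies below a minimal prime
  filter \<open>M\<close>; each \<open>a \<in> M\<close> has a \<open>b \<notin> M\<close> with \<open>a \<squnion> b = 1\<close>, and since \<open>b \<notin> P\<close> it follows
  that \<open>a \<in> P\<close>.  Hence \<open>P = M\<close>.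

  Conversely, if minimal prime filters are pure and \<open>M\<close>, \<open>N\<close> are two of them inside one prime
  filter, then \<open>M = \<sigma>(M) \<subseteq> N\<close> because \<open>N\<close> is among the filters intersected in \<open>\<sigma>(M)\<close>.
\<close>

section \<open>Filters and their quotients\<close>

lemma mult_mono_left: "(x::'a::residuated_lattice) \<le> y \<Longrightarrow> x * z \<le> y * z"
  by (meson order_refl order_trans residuation)

lemma mult_mono_both:
  fixes a b c d :: "'a::residuated_lattice"
  assumes "a \<le> b" "c \<le> d"
  shows "a * c \<le> b * d"
  using mult_mono_left[OF assms(1), of c] mult_mono_left[OF assms(2), of b]
  by (simp add: mult.commute)

lemma le_one: "x \<le> (1::'a::residuated_lattice)"
  by (simp add: one_eq_top)

lemma mult_le_left: "x * y \<le> (x::'a::residuated_lattice)"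
  using mult_mono_both[OF order_refl le_one, of x y] by simp

text \<open>
  Multiplication by a fixed element is a left adjoint, so it distributes over joins; expanding
  the product leaves \<open>x * y\<close> and terms below \<open>s\<close>.  This inequality is why the sets
  \<open>{x. x \<squnion> s \<in> P}\<close> are closed under multiplication.
\<close>

lemma sup_mult_sup_le:
  fixes x y s :: "'a::residuated_lattice"
  shows "sup x s * sup y s \<le> sup (x * y) s"
proof -
  have *: "x * y \<le> sup (x * y) s" "x * s \<le> sup (x * y) s" "s * t \<le> sup (x * y) s" for t
    by (simp, metis le_supI2 mult.commute mult_le_left, metis le_supI2 mult_le_left)
  have "y \<le> residuum x (sup (x * y) s)" "s \<le> residuum x (sup (x * y) s)"
    using *(1,2) by (simp_all add: residuation[symmetric] mult.commute)
  then have "x * sup y s \<le> sup (x * y) s"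
    by (metis le_sup_iff mult.commute residuation)
  then show ?thesis
    using *(3)[of "sup y s"] by (metis le_sup_iff residuation)
qed

lemma rl_filterI:
  fixes F :: "'a::residuated_lattice set"
  assumes "1 \<in> F" "\<And>x y. x \<in> F \<Longrightarrow> y \<in> F \<Longrightarrow> x * y \<in> F"
    and "\<And>x y. x \<in> F \<Longrightarrow> x \<le> y \<Longrightarrow> y \<in> F"
  shows "F \<in> rl_filters"
  using assms unfolding rl_filters_def by (auto intro: sup_ge1)

lemma rl_filter_upward:
  assumes "F \<in> rl_filters" "x \<in> F" "x \<le> y"
  shows "y \<in> F"
  using assms unfolding rl_filters_def by (metis (no_types, lifting) mem_Collect_eq sup.absorb2)

lemma rl_filter_mult: "F \<in> rl_filters \<Longrightarrow> x \<in> F \<Longrightarrow> y \<in> F \<Longrightarrow> x * y \<in> F"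
  unfolding rl_filters_def by blast

lemma rl_filter_one:
  assumes "F \<in> rl_filters"
  shows "1 \<in> F"
proof -
  obtain x where "x \<in> F" using assms unfolding rl_filters_def by blast
  then show ?thesis using assms rl_filter_upward by (metis one_eq_top top_greatest)
qed

lemma rl_filter_proper_iff: "F \<in> rl_filters \<Longrightarrow> F \<noteq> UNIV \<longleftrightarrow> bot \<notin> F"
  using rl_filter_upward[of F bot] by auto

lemma one_rl_filter: "{1::'a::residuated_lattice} \<in> rl_filters"
  by (rule rl_filterI) (auto intro: antisym le_one)

text \<open>
  For filters \<open>P\<close> and \<open>S\<close> this is the largest filter whose intersection with \<open>S\<close> lies in \<open>P\<close>.  It
  serves twice: with \<open>P = {1}\<close> it gives coannihilators, and with \<open>P\<close> prime it enlarges \<open>P\<close>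
  without an explicit description of generated filters.
\<close>

definition join_quotient :: "'a::residuated_lattice set \<Rightarrow> 'a set \<Rightarrow> 'a set" where
  "join_quotient P S = {x. \<forall>s\<in>S. sup x s \<in> P}"

lemma join_quotient_filter:
  assumes P: "P \<in> rl_filters"
  shows "join_quotient P S \<in> rl_filters"
proof (rule rl_filterI)
  show "1 \<in> join_quotient P S"
    using rl_filter_one[OF P] by (simp add: join_quotient_def one_eq_top)
next
  fix x y assume xy: "x \<in> join_quotient P S" "y \<in> join_quotient P S"
  show "x * y \<in> join_quotient P S"
    unfolding join_quotient_def
  proof (intro CollectI ballI)
    fix s assume "s \<in> S"
    then have "sup x s * sup y s \<in> P"
      using xy rl_filter_mult[OF P] by (auto simp: join_quotient_def)
    then show "sup (x * y) s \<in> P"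
      using rl_filter_upward[OF P] sup_mult_sup_le by blast
  qed
next
  fix x y :: 'a assume "x \<in> join_quotient P S" "x \<le> y"
  then show "y \<in> join_quotient P S"
    unfolding join_quotient_def using rl_filter_upward[OF P] by (blast intro: sup_mono)
qed

definition coannihilator :: "'a::residuated_lattice \<Rightarrow> 'a set" where
  "coannihilator a = join_quotient {1} {a}"

lemma mem_coannihilator: "b \<in> coannihilator a \<longleftrightarrow> sup b a = 1"
  by (simp add: coannihilator_def join_quotient_def)

lemma coannihilator_filter: "coannihilator a \<in> rl_filters"
  unfolding coannihilator_def by (intro join_quotient_filter one_rl_filter)

definition filter_join :: "'a::residuated_lattice set \<Rightarrow> 'a set \<Rightarrow> 'a set" where
  "filter_join F G = {z. \<exists>c\<in>F. \<exists>d\<in>G. c * d \<le> z}"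

lemma filter_join_filter:
  assumes F: "F \<in> rl_filters" and G: "G \<in> rl_filters"
  shows "filter_join F G \<in> rl_filters"
proof (rule rl_filterI)
  show "1 \<in> filter_join F G"
    using rl_filter_one[OF F] rl_filter_one[OF G]
    unfolding filter_join_def using le_one by blast
next
  fix x y assume "x \<in> filter_join F G" "y \<in> filter_join F G"
  then obtain c d c' d' where "c \<in> F" "d \<in> G" "c' \<in> F" "d' \<in> G" and le: "c * d \<le> x" "c' * d' \<le> y"
    unfolding filter_join_def by blast
  moreover have "(c * c') * (d * d') \<le> x * y"
    using mult_mono_both[OF le] by (simp add: mult_ac)
  ultimately show "x * y \<in> filter_join F G"
    unfolding filter_join_def using rl_filter_mult[OF F] rl_filter_mult[OF G] by blast
next
  fix x y :: 'a assume "x \<in> filter_join F G" "x \<le> y"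
  then show "y \<in> filter_join F G"
    unfolding filter_join_def using order_trans by blast
qed

lemma filter_join_upper:
  fixes F G :: "'a::residuated_lattice set"
  assumes "F \<in> rl_filters" "G \<in> rl_filters"
  shows "F \<subseteq> filter_join F G" "G \<subseteq> filter_join F G"
proof -
  have "c * 1 \<le> c" "1 * c \<le> c" for c :: 'a by simp_all
  then show "F \<subseteq> filter_join F G" "G \<subseteq> filter_join F G"
    unfolding filter_join_def
    using rl_filter_one[OF assms(1)] rl_filter_one[OF assms(2)] by blast+
qed

section \<open>Prime filters\<close>

lemma prime_filterD:
  assumes "P \<in> prime_filters"
  shows "P \<in> rl_filters" "bot \<notin> P"
  using assms rl_filter_proper_iff unfolding prime_filters_def by auto

text \<open>
  If \<open>x \<squnion> y \<in> P\<close>, the quotient \<open>F\<close> of \<open>P\<close> by \<open>y\<close> contains \<open>x\<close>, and the quotient \<open>G\<close> of \<open>P\<close> by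
  \<open>F\<close> contains \<open>y\<close>.  An element \<open>w\<close> of both satisfies \<open>w = w \<squnion> w \<in> P\<close>, so \<open>F \<inter> G = P\<close> and
  meet-irreducibility applies.
\<close>

lemma prime_filter_sup:
  assumes P: "P \<in> prime_filters" and xy: "sup x y \<in> P"
  shows "x \<in> P \<or> y \<in> P"
proof -
  note fil = prime_filterD(1)[OF P]
  define F where "F = join_quotient P {y}"
  define G where "G = join_quotient P F"
  have "F \<inter> G = P"
  proof
    have "sup w w \<in> P" if "w \<in> F" "w \<in> G" for w
      using that unfolding G_def join_quotient_def by blast
    then show "F \<inter> G \<subseteq> P" by auto
    show "P \<subseteq> F \<inter> G"
      unfolding F_def G_def join_quotient_def using rl_filter_upward[OF fil] sup_ge1 by blast
  qed
  moreover have "F \<in> rl_filters" "G \<in> rl_filters"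
    unfolding F_def G_def using join_quotient_filter fil by auto
  ultimately have "F = P \<or> G = P"
    using P unfolding prime_filters_def by blast
  moreover have "x \<in> F" using xy by (simp add: F_def join_quotient_def)
  moreover have "y \<in> G" by (auto simp: G_def F_def join_quotient_def sup_commute)
  ultimately show ?thesis by blast
qed

lemma prime_filterI:
  assumes P: "P \<in> rl_filters" "bot \<notin> P"
    and sup: "\<And>x y. sup x y \<in> P \<Longrightarrow> x \<in> P \<or> y \<in> P"
  shows "P \<in> prime_filters"
proof -
  have "F = P \<or> G = P" if F: "F \<in> rl_filters" and G: "G \<in> rl_filters" and FG: "F \<inter> G = P" for F G
  proof (rule ccontr)
    assume "\<not> ?thesis"
    then obtain f g where fg: "f \<in> F" "f \<notin> P" "g \<in> G" "g \<notin> P" using FG by blast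
    then have "sup f g \<in> P"
      using rl_filter_upward[OF F, of f "sup f g"] rl_filter_upward[OF G, of g "sup f g"] FG by auto
    then show False using sup fg by blast
  qed
  then show ?thesis
    using P unfolding prime_filters_def by auto
qed

lemma prime_filter_inter:
  assumes P: "P \<in> prime_filters" and F: "F \<in> rl_filters" and G: "G \<in> rl_filters"
    and FG: "F \<inter> G \<subseteq> P"
  shows "F \<subseteq> P \<or> G \<subseteq> P"
proof (rule ccontr)
  assume "\<not> ?thesis"
  then obtain f g where fg: "f \<in> F" "f \<notin> P" "g \<in> G" "g \<notin> P" by blast
  then have "sup f g \<in> P"
    using rl_filter_upward[OF F, of f "sup f g"] rl_filter_upward[OF G, of g "sup f g"] FG by auto
  then show False using prime_filter_sup[OF P] fg by blast
qed

lemma chain_Union_filter: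
  assumes "C \<noteq> {}" and fil: "\<And>F. F \<in> C \<Longrightarrow> F \<in> rl_filters"
    and chain: "\<And>F G. F \<in> C \<Longrightarrow> G \<in> C \<Longrightarrow> F \<subseteq> G \<or> G \<subseteq> F"
  shows "\<Union>C \<in> rl_filters"
proof (rule rl_filterI)
  show "1 \<in> \<Union>C" using assms(1) fil rl_filter_one by blast
next
  fix x y assume "x \<in> \<Union>C" "y \<in> \<Union>C"
  then obtain F where "F \<in> C" "x \<in> F" "y \<in> F" using chain by blast
  then show "x * y \<in> \<Union>C" using fil rl_filter_mult by blast
next
  fix x y :: 'a assume "x \<in> \<Union>C" "x \<le> y"
  then show "y \<in> \<Union>C" using fil rl_filter_upward by blast
qed

text \<open>
  A filter \<open>P\<close> maximal among those avoiding \<open>S\<close> is prime: two elements outside \<open>P\<close> that join into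
  \<open>P\<close> would make \<open>P\<close> the meet of two strictly larger filters, each of which hits \<open>S\<close>; the join of
  the two hits would lie in \<open>P\<close> and in \<open>S\<close>.
\<close>

lemma prime_filter_separation:
  fixes F S :: "'a::residuated_lattice set"
  assumes F: "F \<in> rl_filters" and disj: "F \<inter> S = {}" and "S \<noteq> {}"
    and S: "\<And>s t. s \<in> S \<Longrightarrow> t \<in> S \<Longrightarrow> sup s t \<in> S"
  obtains P where "P \<in> prime_filters" "F \<subseteq> P" "P \<inter> S = {}"
proof -
  define \<F> where "\<F> = {G \<in> rl_filters. F \<subseteq> G \<and> G \<inter> S = {}}"
  have "\<exists>P\<in>\<F>. \<forall>G\<in>\<F>. P \<subseteq> G \<longrightarrow> G = P"
  proof (rule subset_Zorn_nonempty)
    show "\<F> \<noteq> {}" using F disj unfolding \<F>_def by blast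
    show "\<Union>C \<in> \<F>" if "C \<noteq> {}" "subset.chain \<F> C" for C
    proof -
      have "\<Union>C \<in> rl_filters"
        using that unfolding \<F>_def subset.chain_def
        by (intro chain_Union_filter) blast+
      then show ?thesis using that unfolding \<F>_def subset.chain_def by blast
    qed
  qed
  then obtain P where P: "P \<in> \<F>" and max: "\<And>G. G \<in> \<F> \<Longrightarrow> P \<subseteq> G \<Longrightarrow> G = P"
    by blast
  have fil: "P \<in> rl_filters" and FP: "F \<subseteq> P" and PS: "P \<inter> S = {}"
    using P unfolding \<F>_def by auto
  have hit: "\<exists>s\<in>S. s \<in> G" if "G \<in> rl_filters" "P \<subseteq> G" "G \<noteq> P" for G
    using max[of G] that FP unfolding \<F>_def by blast
  have "G = P \<or> H = P" if G: "G \<in> rl_filters" and H: "H \<in> rl_filters" and GH: "G \<inter> H = P" for G H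
  proof (rule ccontr)
    assume "\<not> ?thesis"
    then obtain s t where st: "s \<in> S" "s \<in> G" "t \<in> S" "t \<in> H"
      using hit[of G] hit[of H] G H GH by blast
    then have "sup s t \<in> P"
      using rl_filter_upward[OF G, of s "sup s t"] rl_filter_upward[OF H, of t "sup s t"] GH by auto
    then show False using S st PS by blast
  qed
  moreover have "P \<noteq> UNIV" using PS \<open>S \<noteq> {}\<close> by blast
  ultimately have "P \<in> prime_filters"
    using fil unfolding prime_filters_def by blast
  then show ?thesis using that FP PS by blast
qed

lemma prime_filter_omitting:
  assumes "F \<in> rl_filters" "x \<notin> F"
  obtains P where "P \<in> prime_filters" "F \<subseteq> P" "x \<notin> P"
  using prime_filter_separation[of F "{x}"] assms by auto

lemma chain_Inter_prime:
  assumes "C \<noteq> {}" and prime: "\<And>P. P \<in> C \<Longrightarrow> P \<in> prime_filters"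
    and chain: "\<And>P Q. P \<in> C \<Longrightarrow> Q \<in> C \<Longrightarrow> P \<subseteq> Q \<or> Q \<subseteq> P"
  shows "\<Inter>C \<in> prime_filters"
proof (rule prime_filterI)
  show "\<Inter>C \<in> rl_filters"
    using prime prime_filterD(1) rl_filter_one rl_filter_mult rl_filter_upward
    by (intro rl_filterI) blast+
  show "bot \<notin> \<Inter>C" using assms(1) prime prime_filterD(2) by blast
  show "x \<in> \<Inter>C \<or> y \<in> \<Inter>C" if xy: "sup x y \<in> \<Inter>C" for x y
  proof (rule ccontr)
    assume "\<not> ?thesis"
    then obtain P where "P \<in> C" "x \<notin> P" "y \<notin> P" using chain by blast
    then show False using xy prime prime_filter_sup by blast
  qed
qed

lemma minimal_prime_below:
  fixes Q :: "'a::residuated_lattice set"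
  assumes Q: "Q \<in> prime_filters"
  obtains M where "M \<in> minimal_prime_filters" "M \<subseteq> Q"
proof -
  \<comment> \<open>Complements turn descending chains of primes into ascending ones.\<close>
  define \<C> where "\<C> = {A. - A \<in> prime_filters \<and> - A \<subseteq> Q}"
  have "\<exists>A\<in>\<C>. \<forall>B\<in>\<C>. A \<subseteq> B \<longrightarrow> B = A"
  proof (rule subset_Zorn_nonempty)
    have "- Q \<in> \<C>" using Q by (simp add: \<C>_def)
    then show "\<C> \<noteq> {}" by blast
    show "\<Union>D \<in> \<C>" if D: "D \<noteq> {}" "subset.chain \<C> D" for D
    proof -
      have "\<Inter>(uminus ` D) \<in> prime_filters"
      proof (rule chain_Inter_prime)
        show "uminus ` D \<noteq> {}" using D(1) by blast
        show "P \<in> prime_filters" if "P \<in> uminus ` D" for P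
          using that D(2) unfolding \<C>_def subset.chain_def by blast
        show "P \<subseteq> R \<or> R \<subseteq> P" if PR: "P \<in> uminus ` D" "R \<in> uminus ` D" for P R
        proof -
          obtain A B where "A \<in> D" "B \<in> D" "P = - A" "R = - B" using PR by blast
          moreover have "A \<subseteq> B \<or> B \<subseteq> A"
            using subset.chain_total[OF D(2)] calculation by blast
          ultimately show ?thesis by blast
        qed
      qed
      moreover have "- \<Union>D = \<Inter>(uminus ` D)" by auto
      moreover have "\<Inter>(uminus ` D) \<subseteq> Q"
        using D unfolding \<C>_def subset.chain_def by blast
      ultimately show ?thesis unfolding \<C>_def by simp
    qed
  qed
  then obtain A where A: "A \<in> \<C>" and max: "\<And>B. B \<in> \<C> \<Longrightarrow> A \<subseteq> B \<Longrightarrow> B = A" by blast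
  have "R = - A" if "R \<in> prime_filters" "R \<subseteq> - A" for R
    using max[of "- R"] that A unfolding \<C>_def by auto
  then have "- A \<in> minimal_prime_filters"
    using A unfolding minimal_prime_filters_def \<C>_def by blast
  then show ?thesis using that A unfolding \<C>_def by blast
qed

lemma minimal_primeD:
  assumes "M \<in> minimal_prime_filters"
  shows "M \<in> prime_filters" "\<And>N. N \<in> prime_filters \<Longrightarrow> N \<subseteq> M \<Longrightarrow> N = M"
  using assms unfolding minimal_prime_filters_def by auto

text \<open>
  Since \<open>Q\<close> is prime, the elements \<open>a \<squnion> u\<close> with \<open>u \<notin> Q\<close> are closed under joins; none of them is
  \<open>1\<close>, because \<open>a\<^sup>\<bottom> \<subseteq> Q\<close>.  A prime filter avoiding them all can contain neither \<open>a\<close> nor any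
  \<open>u \<notin> Q\<close>.
\<close>

lemma minimal_prime_omitting:
  fixes a :: "'a::residuated_lattice"
  assumes Q: "Q \<in> prime_filters" and a: "coannihilator a \<subseteq> Q"
  obtains M where "M \<in> minimal_prime_filters" "M \<subseteq> Q" "a \<notin> M"
proof -
  define S where "S = {sup a u |u. u \<notin> Q}"
  have "bot \<notin> Q" using prime_filterD Q by blast
  then have "S \<noteq> {}" by (auto simp: S_def)
  moreover have "{1} \<inter> S = {}"
    using a mem_coannihilator unfolding S_def by (auto simp: sup_commute)
  moreover have "sup s t \<in> S" if "s \<in> S" "t \<in> S" for s t
  proof -
    obtain u v where uv: "s = sup a u" "u \<notin> Q" "t = sup a v" "v \<notin> Q"
      using \<open>s \<in> S\<close> \<open>t \<in> S\<close> unfolding S_def by blast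
    then have "sup s t = sup a (sup u v)" by (simp add: sup_aci)
    moreover have "sup u v \<notin> Q" using prime_filter_sup[OF Q] uv by blast
    ultimately show ?thesis unfolding S_def by blast
  qed
  ultimately obtain P where P: "P \<in> prime_filters" "P \<inter> S = {}"
    using prime_filter_separation[OF one_rl_filter] by metis
  note up = rl_filter_upward[OF prime_filterD(1)[OF P(1)]]
  have "sup a u \<notin> P" if "u \<notin> Q" for u using that P(2) unfolding S_def by blast
  then have "a \<notin> P" and "P \<subseteq> Q"
    using up[of _ "sup a _"] \<open>bot \<notin> Q\<close> by (meson sup_ge1, meson sup_ge2 subsetI)
  obtain M where "M \<in> minimal_prime_filters" "M \<subseteq> P"
    using minimal_prime_below[OF P(1)] .
  then show ?thesis using that \<open>a \<notin> P\<close> \<open>P \<subseteq> Q\<close> by blast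
qed

lemma minimal_prime_complement:
  assumes M: "M \<in> minimal_prime_filters" and "a \<in> M"
  obtains b where "b \<notin> M" "sup a b = 1"
proof -
  have "\<not> coannihilator a \<subseteq> M"
  proof
    assume "coannihilator a \<subseteq> M"
    then obtain N where "N \<in> minimal_prime_filters" "N \<subseteq> M" "a \<notin> N"
      using minimal_prime_omitting minimal_primeD(1)[OF M] by blast
    then show False using minimal_primeD M \<open>a \<in> M\<close> by blast
  qed
  then obtain b where "b \<notin> M" "b \<in> coannihilator a" by blast
  then show ?thesis using that by (simp add: mem_coannihilator sup_commute)
qed

section \<open>Purity\<close>

lemma sigma_part_subset_prime:
  "Q \<in> prime_filters \<Longrightarrow> P \<in> prime_filters \<Longrightarrow> F \<subseteq> P \<Longrightarrow> Q \<subseteq> P \<Longrightarrow> sigma_part F \<subseteq> Q"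
  unfolding sigma_part_def by blast

lemma sigma_part_subset:
  assumes "F \<in> rl_filters"
  shows "sigma_part F \<subseteq> F"
proof (rule subsetI, rule ccontr)
  fix x assume x: "x \<in> sigma_part F" "x \<notin> F"
  obtain P where "P \<in> prime_filters" "F \<subseteq> P" "x \<notin> P"
    using prime_filter_omitting[OF assms x(2)] .
  then show False using x(1) sigma_part_subset_prime[of P P F] by blast
qed

lemma pure_filterI:
  assumes "F \<in> rl_filters"
    and "\<And>P Q. P \<in> prime_filters \<Longrightarrow> Q \<in> prime_filters \<Longrightarrow> F \<subseteq> P \<Longrightarrow> Q \<subseteq> P \<Longrightarrow> F \<subseteq> Q"
  shows "F \<in> pure_filters"
proof -
  have "F \<subseteq> sigma_part F" using assms(2) unfolding sigma_part_def by blast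
  then show ?thesis
    using assms(1) sigma_part_subset unfolding pure_filters_def by blast
qed

lemma pure_filterD:
  assumes "F \<in> pure_filters"
  shows "F \<in> rl_filters" "sigma_part F = F"
  using assms unfolding pure_filters_def by auto

section \<open>Purely-prime filters of mp residuated lattices\<close>

lemma mp_unique:
  fixes P :: "'a::residuated_lattice set"
  assumes "is_mp TYPE('a)" "P \<in> prime_filters"
    and "M \<in> minimal_prime_filters" "M \<subseteq> P" "N \<in> minimal_prime_filters" "N \<subseteq> P"
  shows "M = N"
  using assms unfolding is_mp_def by blast

lemma mp_minimal_prime_pure:
  fixes M :: "'a::residuated_lattice set"
  assumes mp: "is_mp TYPE('a)" and M: "M \<in> minimal_prime_filters"
  shows "M \<in> pure_filters"
proof (rule pure_filterI)
  show "M \<in> rl_filters" using minimal_primeD(1)[OF M] prime_filterD(1) by blast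
  fix P Q :: "'a set"
  assume P: "P \<in> prime_filters" "Q \<in> prime_filters" "M \<subseteq> P" "Q \<subseteq> P"
  obtain N where "N \<in> minimal_prime_filters" "N \<subseteq> Q"
    using minimal_prime_below[OF P(2)] .
  then show "M \<subseteq> Q" using mp_unique[OF mp P(1) M] P by blast
qed

text \<open>
  If \<open>a\<^sup>\<bottom>\<close> and \<open>Q\<close> lie in a prime filter \<open>P\<close>, the only minimal prime filter inside \<open>P\<close> lies also
  inside \<open>Q\<close> and omits \<open>a\<close>; so it contains every \<open>x\<close> with \<open>x \<squnion> a = 1\<close>.
\<close>

lemma mp_coannihilator_pure:
  fixes a :: "'a::residuated_lattice"
  assumes mp: "is_mp TYPE('a)"
  shows "coannihilator a \<in> pure_filters"
proof (rule pure_filterI[OF coannihilator_filter])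
  fix P Q :: "'a set"
  assume P: "P \<in> prime_filters" "Q \<in> prime_filters" "coannihilator a \<subseteq> P" "Q \<subseteq> P"
  obtain M where M: "M \<in> minimal_prime_filters" "M \<subseteq> P" "a \<notin> M"
    using minimal_prime_omitting[OF P(1,3)] .
  obtain N where N: "N \<in> minimal_prime_filters" "N \<subseteq> Q"
    using minimal_prime_below[OF P(2)] .
  have "M \<subseteq> Q" using mp_unique[OF mp P(1) M(1,2) N(1)] N(2) P(4) by blast
  moreover have "x \<in> M" if "x \<in> coannihilator a" for x
  proof -
    note M_prime = minimal_primeD(1)[OF M(1)]
    have "sup x a \<in> M"
      using that rl_filter_one[OF prime_filterD(1)[OF M_prime]] by (simp add: mem_coannihilator)
    then show ?thesis using prime_filter_sup[OF M_prime] M(3) by blast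
  qed
  ultimately show "coannihilator a \<subseteq> Q" by blast
qed

text \<open>
  A prime filter containing both coannihilators would include a minimal prime filter omitting \<open>x\<close>
  and one omitting \<open>y\<close>.  They coincide by mp, although a prime filter contains \<open>x\<close> or \<open>y\<close>.
\<close>

lemma mp_coannihilators_comaximal:
  fixes x y :: "'a::residuated_lattice"
  assumes mp: "is_mp TYPE('a)" and xy: "sup x y = 1"
  obtains c d where "sup c x = 1" "sup d y = 1" "c * d = bot"
proof -
  let ?J = "filter_join (coannihilator x) (coannihilator y)"
  have "bot \<in> ?J"
  proof (rule ccontr)
    assume "bot \<notin> ?J"
    then obtain P where P: "P \<in> prime_filters" "?J \<subseteq> P"
      using prime_filter_omitting filter_join_filter coannihilator_filter by metis
    then have "coannihilator x \<subseteq> P" "coannihilator y \<subseteq> P"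
      using filter_join_upper[OF coannihilator_filter coannihilator_filter] by blast+
    then obtain M N where M: "M \<in> minimal_prime_filters" "M \<subseteq> P" "x \<notin> M"
      and N: "N \<in> minimal_prime_filters" "N \<subseteq> P" "y \<notin> N"
      using minimal_prime_omitting[OF P(1)] by metis
    have "M = N" using mp_unique[OF mp P(1)] M N by blast
    moreover note M_prime = minimal_primeD(1)[OF M(1)]
    have "sup x y \<in> M" using rl_filter_one[OF prime_filterD(1)[OF M_prime]] xy by simp
    ultimately show False using prime_filter_sup[OF M_prime] M(3) N(3) by blast
  qed
  then show ?thesis
    using that unfolding filter_join_def mem_coannihilator[symmetric]
    by (auto simp: bot_unique)
qed

lemma coannihilator_inter_trivial:
  assumes "c * d = bot"
  shows "coannihilator c \<inter> coannihilator d = {1}"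
proof
  show "coannihilator c \<inter> coannihilator d \<subseteq> {1}"
  proof
    fix w assume "w \<in> coannihilator c \<inter> coannihilator d"
    then have "sup c w = 1" "sup d w = 1" by (auto simp: mem_coannihilator sup_commute)
    then have "1 \<le> w" using sup_mult_sup_le[of c w d] assms by simp
    then show "w \<in> {1}" by (simp add: one_eq_top top_unique)
  qed
  show "{1} \<subseteq> coannihilator c \<inter> coannihilator d"
    using rl_filter_one[OF coannihilator_filter] by blast
qed

text \<open>
  The obvious pure filters around \<open>x\<close> and \<open>y\<close>, namely \<open>y\<^sup>\<bottom>\<close> and \<open>x\<^sup>\<bottom>\<close>, may have an
  intersection larger than \<open>{1}\<close>.  Comaximality supplies the filters \<open>c\<^sup>\<bottom>\<close> and \<open>d\<^sup>\<bottom>\<close>, which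
  still contain \<open>x\<close> and \<open>y\<close> but meet only in \<open>1\<close>.
\<close>

lemma mp_purely_prime_cover:
  fixes x y :: "'a::residuated_lattice"
  assumes mp: "is_mp TYPE('a)" and P: "P \<in> purely_prime_filters" and xy: "sup x y = 1"
  shows "x \<in> P \<or> y \<in> P"
proof -
  obtain c d where cd: "sup c x = 1" "sup d y = 1" "c * d = bot"
    using mp_coannihilators_comaximal[OF mp xy] .
  have "P \<in> rl_filters"
    using P pure_filterD(1) unfolding purely_prime_filters_def by blast
  then have "coannihilator c \<inter> coannihilator d \<subseteq> P"
    using coannihilator_inter_trivial[OF cd(3)] rl_filter_one by auto
  then have "coannihilator c \<subseteq> P \<or> coannihilator d \<subseteq> P"
    using P mp_coannihilator_pure[OF mp] unfolding purely_prime_filters_def by blast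
  moreover have "x \<in> coannihilator c" "y \<in> coannihilator d"
    using cd by (simp_all add: mem_coannihilator sup_commute)
  ultimately show ?thesis by blast
qed

lemma prime_pure_imp_purely_prime:
  assumes "P \<in> prime_filters" "P \<in> pure_filters"
  shows "P \<in> purely_prime_filters"
proof -
  have "P \<noteq> UNIV" using prime_filterD(2)[OF assms(1)] by blast
  then show ?thesis
    using assms prime_filter_inter pure_filterD(1) unfolding purely_prime_filters_def by blast
qed

lemma mp_purely_prime_minimal:
  fixes P :: "'a::residuated_lattice set"
  assumes mp: "is_mp TYPE('a)" and P: "P \<in> purely_prime_filters"
  shows "P \<in> minimal_prime_filters"
proof -
  have pure: "P \<in> pure_filters" and "P \<noteq> UNIV"
    using P unfolding purely_prime_filters_def by auto
  then obtain Q where Q: "Q \<in> prime_filters" "P \<subseteq> Q"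
    using prime_filter_omitting[OF pure_filterD(1)[OF pure]] by (metis UNIV_eq_I)
  obtain M where M: "M \<in> minimal_prime_filters" "M \<subseteq> Q"
    using minimal_prime_below[OF Q(1)] .
  have "P \<subseteq> M"
    using sigma_part_subset_prime[OF minimal_primeD(1)[OF M(1)] Q M(2)] pure_filterD(2)[OF pure]
    by simp
  moreover have "M \<subseteq> P"
  proof
    fix a assume "a \<in> M"
    then obtain b where "b \<notin> M" "sup a b = 1"
      using minimal_prime_complement[OF M(1)] by blast
    then show "a \<in> P" using mp_purely_prime_cover[OF mp P] \<open>P \<subseteq> M\<close> by blast
  qed
  ultimately show ?thesis using M(1) by simp
qed

lemma minimal_primes_pure_imp_mp:
  assumes pure: "\<And>M::'a::residuated_lattice set. M \<in> minimal_prime_filters \<Longrightarrow> M \<in> pure_filters"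
  shows "is_mp TYPE('a)"
  unfolding is_mp_def
proof (intro ballI ex_ex1I)
  fix P :: "'a set" assume P: "P \<in> prime_filters"
  then show "\<exists>M. M \<in> minimal_prime_filters \<and> M \<subseteq> P"
    using minimal_prime_below by blast
  fix M N
  assume M: "M \<in> minimal_prime_filters \<and> M \<subseteq> P" and N: "N \<in> minimal_prime_filters \<and> N \<subseteq> P"
  have "sigma_part M \<subseteq> N"
    using sigma_part_subset_prime[OF _ P] M N minimal_primeD(1) by blast
  then have "M \<subseteq> N" using pure_filterD(2)[OF pure] M by blast
  then show "M = N" using minimal_primeD M N by blast
qed

theorem theorem4p14:
  shows "is_mp TYPE('a::residuated_lattice) \<longleftrightarrow>
    (minimal_prime_filters :: 'a set set) = purely_prime_filters"
proof
  assume mp: "is_mp TYPE('a)"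
  show "(minimal_prime_filters :: 'a set set) = purely_prime_filters"
    using mp_purely_prime_minimal[OF mp] mp_minimal_prime_pure[OF mp]
      prime_pure_imp_purely_prime minimal_primeD(1) by blast
next
  assume "(minimal_prime_filters :: 'a set set) = purely_prime_filters"
  then have "M \<in> pure_filters" if "M \<in> minimal_prime_filters" for M :: "'a set"
    using that unfolding purely_prime_filters_def by blast
  then show "is_mp TYPE('a)" by (rule minimal_primes_pure_imp_mp)
qed

end
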